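(* Let $n\geq 3$ be an integer, $p$ a prime and $G=\mathbb Z_p\operatorname{wr}\operatorname{Sym}(n)$, with $\operatorname{Sym}(n)$ acting naturally on $\{1,\ldots,n\}$. Let $B$ be the base group of $G$. (1) If $p<n$ and $p$ does not divide $n$, then $P(G)=\operatorname{Alt}(n)\ltimes B$. (2) If $p<n$ and $p$ divides $n$, then $P(G)=\operatorname{Alt}(n)\ltimes[\operatorname{Alt}(n),B]$. (3) If $p=n$, then $P(G)=[\operatorname{Alt}(n),B]$. (4) If $p>n$, then $P(G)=B$.
   Context: For a group $G$, the pseudocentre is $P(G)=\bigcap_{x\in G}C_G(x)^G$, where $C_G(x)$ is the centralizer of $x$ in $G$ and, for a subgroup $H\leq G$, $H^G$ is the normal closure of $H$ in $G$. Here $\mathbb Z_p$ is the cyclic group of order $p$, and $\mathbb Z_p\operatorname{wr}\operatorname{Sym}(n)$ is the permutational wreath product $\operatorname{Sym}(n)\ltimes B$, where the base group $B=\mathbb Z_p^n$ is the direct product of $n$ copies of $\mathbb Z_p$ and $\operatorname{Sym}(n)$ permutes the $n$ coordinates naturally. $[\operatorname{Alt}(n),B]$ is the subgroup generated by all commutators $[x,b]$ with $x\in\operatorname{Alt}(n)$, $b\in B$. *)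

theory Defs
  imports
    "HOL-Algebra.Sym_Groups"
    "HOL-Algebra.Product_Groups"
    "HOL-Algebra.Elementary_Groups"
    "HOL-Computational_Algebra.Primes"
begin

section \<open>The pseudocentre\<close>

definition centralizer :: "('a, 'b) monoid_scheme \<Rightarrow> 'a \<Rightarrow> 'a set"
  where "centralizer G x = {g \<in> carrier G. g \<otimes>\<^bsub>G\<^esub> x = x \<otimes>\<^bsub>G\<^esub> g}"

definition normal_closure :: "('a, 'b) monoid_scheme \<Rightarrow> 'a set \<Rightarrow> 'a set"
  where "normal_closure G H = \<Inter>{N. N \<lhd> G \<and> H \<subseteq> N}"

definition pseudocentre :: "('a, 'b) monoid_scheme \<Rightarrow> 'a set"
  where "pseudocentre G = (\<Inter>x\<in>carrier G. normal_closure G (centralizer G x))"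

definition commutator_subgroup :: "('a, 'b) monoid_scheme \<Rightarrow> 'a set \<Rightarrow> 'a set \<Rightarrow> 'a set"
  where "commutator_subgroup G H K =
    generate G {inv\<^bsub>G\<^esub> x \<otimes>\<^bsub>G\<^esub> inv\<^bsub>G\<^esub> y \<otimes>\<^bsub>G\<^esub> x \<otimes>\<^bsub>G\<^esub> y | x y. x \<in> H \<and> y \<in> K}"


section \<open>Semidirect products\<close>

text \<open>
  The external semidirect product of \<open>H\<close> acting on \<open>N\<close> from the left through \<open>\<phi>\<close>.
  The pair \<open>(h, a)\<close> stands for the product of \<open>a \<in> N\<close> and \<open>h \<in> H\<close>, in this order, so that
  conjugation by \<open>h\<close> (that is, \<open>h a h\<inverse>\<close>) is the action \<open>\<phi> h\<close>.
\<close>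

definition semidirect_product ::
    "('h, 'c) monoid_scheme \<Rightarrow> ('a, 'd) monoid_scheme \<Rightarrow> ('h \<Rightarrow> 'a \<Rightarrow> 'a) \<Rightarrow> ('h \<times> 'a) monoid"
  where "semidirect_product H N \<phi> =
    \<lparr>carrier = carrier H \<times> carrier N,
     mult = (\<lambda>(h, a) (k, b). (h \<otimes>\<^bsub>H\<^esub> k, a \<otimes>\<^bsub>N\<^esub> \<phi> h b)),
     one = (\<one>\<^bsub>H\<^esub>, \<one>\<^bsub>N\<^esub>)\<rparr>"

text \<open>
  \<open>K = H \<ltimes> N\<close> for subsets of an ambient group \<open>G\<close>: the internal semidirect product of the
  subgroups \<open>H\<close> and \<open>N\<close>, where \<open>N\<close> is normal in \<open>K\<close> (not necessarily in \<open>G\<close>).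
\<close>

definition is_internal_semidirect_product ::
    "('a, 'b) monoid_scheme \<Rightarrow> 'a set \<Rightarrow> 'a set \<Rightarrow> 'a set \<Rightarrow> bool"
  where "is_internal_semidirect_product G K H N \<longleftrightarrow>
    subgroup K G \<and> subgroup H G \<and> N \<lhd> (G\<lparr>carrier := K\<rparr>) \<and>
    H \<inter> N = {\<one>\<^bsub>G\<^esub>} \<and> K = H <#>\<^bsub>G\<^esub> N"


section \<open>The permutational wreath product with the symmetric group\<close>

text \<open>
  The left action of \<open>\<sigma>\<close> moves the entry in coordinate \<open>i\<close> to coordinate \<open>\<sigma> i\<close>, whence the inverse.
\<close>

definition wreath_Sym :: "('a, 'b) monoid_scheme \<Rightarrow> nat \<Rightarrow> ((nat \<Rightarrow> nat) \<times> (nat \<Rightarrow> 'a)) monoid"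
  where "wreath_Sym A n =
    semidirect_product (sym_group n) (product_group {1..n} (\<lambda>_. A)) (\<lambda>\<sigma> f. f \<circ> inv' \<sigma>)"

definition base_group :: "('a, 'b) monoid_scheme \<Rightarrow> nat \<Rightarrow> ((nat \<Rightarrow> nat) \<times> (nat \<Rightarrow> 'a)) set"
  where "base_group A n = {\<one>\<^bsub>sym_group n\<^esub>} \<times> carrier (product_group {1..n} (\<lambda>_. A))"

definition Alt_in_wreath :: "('a, 'b) monoid_scheme \<Rightarrow> nat \<Rightarrow> ((nat \<Rightarrow> nat) \<times> (nat \<Rightarrow> 'a)) set"
  where "Alt_in_wreath A n = carrier (alt_group n) \<times> {\<one>\<^bsub>product_group {1..n} (\<lambda>_. A)\<^esub>}"

end

theory Submission
  imports Defs
begin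

text \<open>
  Write \<open>M\<close> for the vectors of \<open>B\<close> with entry sum zero; this is \<open>[Alt(n), B]\<close>.
  Let \<open>N\<close> be a normal subgroup containing \<open>C(x)\<close>, with \<open>x\<close> lying over \<open>\<sigma>\<close>. Since \<open>x \<in> N\<close> if \<open>\<sigma> \<noteq> 1\<close>
  and \<open>B \<subseteq> N\<close> if \<open>\<sigma> = 1\<close>, some nonconstant vector lies in \<open>N\<close>, which forces \<open>M \<subseteq> N\<close>. The constant vectors
  are central, and they complete \<open>M\<close> to \<open>B\<close> when \<open>p\<close> does not divide \<open>n\<close>. For \<open>p < n\<close> a commutator
  of an element of \<open>C(x)\<close> with a transposition is a 3-cycle modulo \<open>M\<close>, so that \<open>Alt(n) \<subseteq> N\<close>.
  The upper bounds come from three centralizers: that of a vector with distinct entries (\<open>p \<ge> n\<close>)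
  is \<open>B\<close>; that of a cycle of odd length \<open>n\<close> or \<open>n - 1\<close> lies over \<open>Alt(n)\<close>; and that of an \<open>n\<close>-cycle has
  constant base components, whose entry sum vanishes if \<open>p\<close> divides \<open>n\<close>.
\<close>

text \<open>Coordinates run over \<open>{1..n}\<close> and coordinate \<open>1\<close> is singled
  out below; otherwise simp would turn \<open>1\<close> into \<open>Suc 0\<close>.\<close>

declare One_nat_def [simp del]

section \<open>Symmetric groups\<close>

text \<open>Multiple transitivity of Sym(S). A permutation found for the tails is corrected by the
  transposition of \<open>\<rho> x\<close> and \<open>y\<close>, which fixes every entry of
  \<open>ys\<close> because neither point occurs there.\<close>

lemma permutes_map_list_exists:
  assumes "distinct xs" "distinct ys" "length xs = length ys" "set xs \<subseteq> S" "set ys \<subseteq> S"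
  shows "\<exists>\<rho>. \<rho> permutes S \<and> map \<rho> xs = ys"
  using assms(3,1,2,4,5)
proof (induction xs ys rule: list_induct2)
  case Nil
  show "\<exists>\<rho>. \<rho> permutes S \<and> map \<rho> [] = []" by (intro exI[of _ id] conjI permutes_id) simp
next
  case (Cons x xs y ys)
  then obtain \<rho> where \<rho>: "\<rho> permutes S" "map \<rho> xs = ys" by auto
  have inj: "inj \<rho>" using \<rho>(1) by (rule permutes_inj)
  have "\<rho> x \<notin> set ys"
    using Cons.prems(1) \<rho>(2) inj by (auto simp: inj_eq)
  moreover have "y \<notin> set ys" using Cons.prems by simp
  ultimately have "map (transpose (\<rho> x) y) ys = ys"
    by (auto intro!: map_idI simp: transpose_def)
  moreover have "map (transpose (\<rho> x) y \<circ> \<rho>) xs = map (transpose (\<rho> x) y) ys"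
    using \<rho>(2) by auto
  ultimately have "map (transpose (\<rho> x) y \<circ> \<rho>) (x # xs) = y # ys" by simp
  moreover have "(transpose (\<rho> x) y \<circ> \<rho>) permutes S"
    using Cons.prems \<rho>(1) by (auto intro!: permutes_compose permutes_swap_id simp: permutes_in_image)
  ultimately show "\<exists>\<rho>. \<rho> permutes S \<and> map \<rho> (x # xs) = y # ys" by (intro exI conjI)
qed

text \<open>All 3-cycles are conjugate in Sym(n), so one of them brings all the others into
  \<open>L\<close>, and together they generate Alt(n).\<close>

lemma alt_group_subset_normal:
  assumes L: "L \<lhd> sym_group n"
    and abc: "cycle_of_list [a, b, c] \<in> L" "distinct [a, b, c]" "{a, b, c} \<subseteq> {1..n}"
  shows "carrier (alt_group n) \<subseteq> L"
proof -
  interpret S: group "sym_group n" by (rule sym_group_is_group)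
  have sub: "subgroup L (sym_group n)" using L by (rule normal_imp_subgroup)
  have three: "three_cycles n \<subseteq> L"
  proof
    fix q assume "q \<in> three_cycles n"
    then obtain cs where cs: "q = cycle_of_list cs" "distinct cs" "length cs = 3" "set cs \<subseteq> {1..n}"
      by auto
    obtain \<rho> where \<rho>: "\<rho> permutes {1..n}" "map \<rho> [a, b, c] = cs"
      using permutes_map_list_exists[of "[a, b, c]" cs "{1..n}"] abc cs by auto
    have "\<rho> \<circ> cycle_of_list [a, b, c] \<circ> inv' \<rho> = q"
      using conjugation_of_cycle[OF abc(2), of \<rho>] \<rho> cs(1) permutes_bij by metis
    moreover have "\<rho> \<circ> cycle_of_list [a, b, c] \<circ> inv' \<rho> \<in> L"
      using S.normal_invE(2)[OF L, of \<rho> "cycle_of_list [a, b, c]"] \<rho>(1) abc(1)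
      by (simp add: sym_group_carrier sym_group_mult)
    ultimately show "q \<in> L" by simp
  qed
  have "carrier (alt_group n) = generate (sym_group n) (three_cycles n)"
    using alt_group_carrier_as_three_cycles[of n] three_cycles_incl[of n]
      S.generate_consistent[OF _ alt_group_is_subgroup[of n], of "three_cycles n"]
    by (simp add: alt_group_def)
  also have "\<dots> \<subseteq> L" by (rule S.generate_subgroup_incl[OF three sub])
  finally show ?thesis .
qed

section \<open>Centralizers of odd cycles\<close>

lemma evenperm_of_odd_order:
  assumes "permutation \<sigma>" "\<sigma> ^^ m = id" "odd m"
  shows "evenperm \<sigma>"
proof -
  have "sign (\<sigma> ^^ k) = sign \<sigma> ^ k" for k
  proof (induction k)
    case 0
    show "sign (\<sigma> ^^ 0) = sign \<sigma> ^ 0" by simp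
  next
    case (Suc k)
    then show "sign (\<sigma> ^^ Suc k) = sign \<sigma> ^ Suc k"
      using sign_compose[OF assms(1) permutation_funpow[OF assms(1), of k]] by simp
  qed
  from this[of m] have "sign \<sigma> ^ m = 1" using assms(2) by simp
  then show ?thesis using assms(3) by (auto simp: sign_def split: if_splits)
qed

lemma cycle_funpow_hd:
  assumes "distinct cs" "cs \<noteq> []"
  shows "(cycle_of_list cs ^^ k) (cs ! 0) = cs ! (k mod length cs)"
proof -
  have "map (cycle_of_list cs ^^ k) cs ! 0 = rotate k cs ! 0"
    using cyclic_rotation[OF assms(1), of k] by simp
  then show ?thesis using assms(2) by (simp add: nth_rotate)
qed

text \<open>Such a \<open>\<tau>\<close> fixes the point of \<open>S\<close> missed by the cycle, if
  there is one, and therefore agrees with a power of the cycle. Its order divides the odd length of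
  the cycle.\<close>

lemma commutes_cycle_evenperm:
  assumes cs: "distinct cs" "odd (length cs)" "1 < length cs" "set cs \<subseteq> S" "card (S - set cs) \<le> 1"
    and S: "finite S" and \<tau>: "\<tau> permutes S"
    and comm: "\<tau> \<circ> cycle_of_list cs = cycle_of_list cs \<circ> \<tau>"
  shows "evenperm \<tau>"
proof -
  define \<sigma> where "\<sigma> = cycle_of_list cs"
  define m where "m = length cs"
  have m: "m > 0" using cs(3) unfolding m_def by linarith
  have rot: "(\<sigma> ^^ k) (cs ! 0) = cs ! (k mod m)" for k
    using cycle_funpow_hd[OF cs(1), of k] cs(3) unfolding \<sigma>_def m_def by fastforce
  have out: "\<sigma> x = x" if "x \<notin> set cs" for x
    using id_outside_supp[OF that] by (simp add: \<sigma>_def)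
  have moved: "\<sigma> x \<noteq> x" if x: "x \<in> set cs" for x
  proof -
    obtain k where k: "k < m" "x = cs ! k" using x by (auto simp: in_set_conv_nth m_def)
    have "\<sigma> x = (\<sigma> ^^ Suc k) (cs ! 0)" using rot[of k] k by simp
    also have "\<dots> = cs ! (Suc k mod m)" by (rule rot)
    finally have "\<sigma> x = cs ! (Suc k mod m)" .
    moreover have "Suc k mod m \<noteq> k" "Suc k mod m < m" using k(1) cs(3) by (auto simp: m_def mod_Suc)
    ultimately show ?thesis using k cs(1) by (simp add: m_def nth_eq_iff_index_eq)
  qed
  have inj: "inj \<tau>" using \<tau> by (rule permutes_inj)
  have comm1: "\<tau> (\<sigma> x) = \<sigma> (\<tau> x)" for x
    using fun_cong[OF comm, of x] by (simp add: \<sigma>_def)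
  have pow: "(\<sigma> ^^ k) (\<tau> x) = \<tau> ((\<sigma> ^^ k) x)" for k x
    by (induction k) (simp_all add: comm1)
  \<comment> \<open>The points outside \<open>cs\<close> are the fixed points of
    \<open>\<sigma>\<close>, and \<open>\<tau>\<close> maps them to such points again;
    \<open>S\<close> contains at most one of them.\<close>
  have fixpt: "\<tau> x = x" if x: "x \<notin> set cs" for x
  proof (cases "x \<in> S")
    case True
    have "\<sigma> (\<tau> x) = \<tau> x" using comm1[of x] out[OF x] by simp
    then have "\<tau> x \<notin> set cs" using moved by blast
    moreover have "\<tau> x \<in> S" using True \<tau> by (simp add: permutes_in_image)
    ultimately have "{x, \<tau> x} \<subseteq> S - set cs" using True x by auto
    then have "card {x, \<tau> x} \<le> 1"
      using card_mono[of "S - set cs"] S cs(5) by (meson finite_Diff le_trans)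
    then show ?thesis by (cases "\<tau> x = x") auto
  qed (use \<tau> in \<open>auto simp: permutes_def\<close>)
  have "\<tau> ^^ m = id"
  proof -
    have in0: "cs ! 0 \<in> set cs" using m by (simp add: m_def)
    have "\<tau> (cs ! 0) \<in> set cs"
    proof (rule ccontr)
      assume *: "\<tau> (cs ! 0) \<notin> set cs"
      then have "\<tau> (\<tau> (cs ! 0)) = \<tau> (cs ! 0)" using fixpt by blast
      then have "\<tau> (cs ! 0) = cs ! 0" using inj by (simp add: inj_eq)
      then show False using * in0 by simp
    qed
    then obtain k where k: "k < m" "\<tau> (cs ! 0) = cs ! k" by (auto simp: in_set_conv_nth m_def)
    \<comment> \<open>On \<open>cs\<close>, both sides agree at the head and commute with
      \<open>\<sigma>\<close>, whose powers carry the head to every entry.\<close>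
    have "\<tau> x = (\<sigma> ^^ k) x" for x
    proof (cases "x \<in> set cs")
      case True
      then obtain j where j: "j < m" "x = cs ! j" by (auto simp: in_set_conv_nth m_def)
      have x: "x = (\<sigma> ^^ j) (cs ! 0)" using rot[of j] j by simp
      have "\<tau> x = (\<sigma> ^^ j) (\<tau> (cs ! 0))" unfolding x by (rule pow[symmetric])
      also have "\<dots> = (\<sigma> ^^ j) ((\<sigma> ^^ k) (cs ! 0))" using rot[of k] k by simp
      also have "\<dots> = (\<sigma> ^^ k) ((\<sigma> ^^ j) (cs ! 0))"
        using fun_cong[OF funpow_add[of j k \<sigma>]] fun_cong[OF funpow_add[of k j \<sigma>]]
        by (simp add: add.commute)
      finally show ?thesis unfolding x[symmetric] .
    next
      case False
      have "(\<sigma> ^^ k) x = x" by (induction k) (simp_all add: out False)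
      then show ?thesis using fixpt[OF False] by simp
    qed
    then have "\<tau> = \<sigma> ^^ k" by auto
    then have "\<tau> ^^ m = (\<sigma> ^^ m) ^^ k" by (simp add: funpow_mult mult.commute)
    also have "\<dots> = id" using cycle_is_id_root[OF cs(1)] by (simp add: \<sigma>_def m_def)
    finally show ?thesis .
  qed
  moreover have "permutation \<tau>" using S \<tau> by (auto simp: permutation_permutes)
  ultimately show ?thesis using cs(2) evenperm_of_odd_order by (auto simp: m_def)
qed

section \<open>The wreath product of \<open>\<int>\<^sub>p\<close> and the symmetric group\<close>

text \<open>For \<open>p > 0\<close> the carrier of \<open>integer_mod_group p\<close> is
  \<open>{0..<int p}\<close>; for \<open>p = 0\<close> it would be the set of all integers.\<close>

locale cyclic_wreath =
  fixes n p :: nat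
  assumes p_pos: "p > 0"
begin

abbreviation G where "G \<equiv> wreath_Sym (integer_mod_group p) n"

text \<open>
  Base group elements are given by arbitrary integer vectors, so that products in \<open>G\<close> need no
  reduction modulo \<open>p\<close>.
\<close>

definition wr :: "(nat \<Rightarrow> nat) \<Rightarrow> (nat \<Rightarrow> int) \<Rightarrow> (nat \<Rightarrow> nat) \<times> (nat \<Rightarrow> int)"
  where "wr \<sigma> v = (\<sigma>, \<lambda>i\<in>{1..n}. v i mod int p)"

lemma wr_eq_iff: "wr \<sigma> v = wr \<tau> w \<longleftrightarrow> \<sigma> = \<tau> \<and> (\<forall>i\<in>{1..n}. v i mod int p = w i mod int p)"
  by (auto simp: wr_def restrict_def fun_eq_iff)

lemma carrier_G: "carrier G = {wr \<sigma> v |\<sigma> v. \<sigma> permutes {1..n}}"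
proof -
  have "(\<sigma>, f) = wr \<sigma> f" if "f \<in> {1..n} \<rightarrow>\<^sub>E {0..<int p}" for \<sigma> f
  proof -
    have "f = (\<lambda>i\<in>{1..n}. f i mod int p)"
    proof
      fix i show "f i = (\<lambda>i\<in>{1..n}. f i mod int p) i"
        using PiE_mem[OF that, of i] PiE_arb[OF that, of i] by (cases "i \<in> {1..n}") auto
    qed
    then show ?thesis by (simp add: wr_def)
  qed
  then show ?thesis using p_pos
    by (auto simp: wreath_Sym_def semidirect_product_def sym_group_carrier carrier_integer_mod_group)
      (auto simp: wr_def)
qed

lemma wr_carrier [simp]: "\<sigma> permutes {1..n} \<Longrightarrow> wr \<sigma> v \<in> carrier G"
  by (auto simp: carrier_G)

lemma one_G: "\<one>\<^bsub>G\<^esub> = wr id (\<lambda>_. 0)"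
  by (simp add: wreath_Sym_def semidirect_product_def sym_group_one wr_def)

lemma wr_mult:
  assumes "\<sigma> permutes {1..n}"
  shows "wr \<sigma> v \<otimes>\<^bsub>G\<^esub> wr \<tau> w = wr (\<sigma> \<circ> \<tau>) (\<lambda>i. v i + w (inv' \<sigma> i))"
proof -
  have "inv' \<sigma> i \<in> {1..n}" if "i \<in> {1..n}" for i
    using permutes_in_image[OF permutes_inv[OF assms]] that by blast
  then show ?thesis
    by (auto simp: wreath_Sym_def semidirect_product_def sym_group_mult wr_def restrict_def
        fun_eq_iff mod_add_eq)
qed

lemma group_G: "group G"
proof (rule groupI)
  fix x y z assume "x \<in> carrier G" "y \<in> carrier G" "z \<in> carrier G"
  then obtain \<sigma> \<tau> \<rho> u v w where *: "x = wr \<sigma> u" "y = wr \<tau> v" "z = wr \<rho> w"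
    "\<sigma> permutes {1..n}" "\<tau> permutes {1..n}" "\<rho> permutes {1..n}"
    by (auto simp: carrier_G)
  have "inv' (\<sigma> \<circ> \<tau>) = inv' \<tau> \<circ> inv' \<sigma>"
    using * by (intro o_inv_distrib permutes_bij)
  then show "x \<otimes>\<^bsub>G\<^esub> y \<otimes>\<^bsub>G\<^esub> z = x \<otimes>\<^bsub>G\<^esub> (y \<otimes>\<^bsub>G\<^esub> z)"
    using * by (simp add: wr_mult permutes_compose comp_assoc add.assoc)
  show "x \<otimes>\<^bsub>G\<^esub> y \<in> carrier G"
    using * by (simp add: wr_mult permutes_compose)
  show "\<one>\<^bsub>G\<^esub> \<otimes>\<^bsub>G\<^esub> x = x"
    using * by (simp add: wr_mult one_G permutes_id)
  have "wr (inv' \<sigma>) (\<lambda>i. - u (\<sigma> i)) \<otimes>\<^bsub>G\<^esub> x = \<one>\<^bsub>G\<^esub>"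
    using * by (simp add: wr_mult one_G permutes_inv permutes_inv_o permutes_inv_inv)
  then show "\<exists>y\<in>carrier G. y \<otimes>\<^bsub>G\<^esub> x = \<one>\<^bsub>G\<^esub>"
    using *(4) permutes_inv wr_carrier by blast
qed (simp add: one_G permutes_id)

sublocale G: group G by (rule group_G)

lemma wr_inv:
  assumes "\<sigma> permutes {1..n}"
  shows "inv\<^bsub>G\<^esub> (wr \<sigma> v) = wr (inv' \<sigma>) (\<lambda>i. - v (\<sigma> i))"
  by (rule G.inv_equality)
    (use assms in \<open>simp_all add: wr_mult one_G permutes_inv permutes_inv_o permutes_inv_inv\<close>)

lemma wr_conj:
  assumes "\<rho> permutes {1..n}" "\<tau> permutes {1..n}"
  shows "wr \<rho> w \<otimes>\<^bsub>G\<^esub> wr \<tau> v \<otimes>\<^bsub>G\<^esub> inv\<^bsub>G\<^esub> (wr \<rho> w) =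
    wr (\<rho> \<circ> \<tau> \<circ> inv' \<rho>) (\<lambda>i. w i + v (inv' \<rho> i) - w (\<rho> (inv' \<tau> (inv' \<rho> i))))"
proof -
  have "inv' (\<rho> \<circ> \<tau>) = inv' \<tau> \<circ> inv' \<rho>"
    using assms by (intro o_inv_distrib permutes_bij)
  then show ?thesis using assms
    by (simp add: wr_mult wr_inv permutes_compose)
qed

section \<open>Normal subgroups defined by the sum of the entries\<close>

lemma sum_permute:
  assumes "\<sigma> permutes {1..n}"
  shows "(\<Sum>i\<in>{1..n}. v (\<sigma> i)) = (\<Sum>i\<in>{1..n}. v i :: int)"
  using sum.permute[OF assms, of v] by (simp add: comp_def)

text \<open>The condition on the sum of the entries is switched off by \<open>d = 0\<close>.\<close>

definition sum_ext :: "(nat \<Rightarrow> nat) set \<Rightarrow> int \<Rightarrow> ((nat \<Rightarrow> nat) \<times> (nat \<Rightarrow> int)) set"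
  where "sum_ext A d = {wr \<sigma> v |\<sigma> v. \<sigma> \<in> A \<and> int p dvd d * (\<Sum>i\<in>{1..n}. v i)}"

text \<open>The choice of integer representatives does not matter: two vectors for the same element
  are congruent modulo \<open>p\<close> in each coordinate, so their sums are congruent.\<close>

lemma wr_in_sum_ext: "wr \<sigma> v \<in> sum_ext A d \<longleftrightarrow> \<sigma> \<in> A \<and> int p dvd d * (\<Sum>i\<in>{1..n}. v i)"
proof
  assume "wr \<sigma> v \<in> sum_ext A d"
  then obtain \<tau> w where w: "wr \<sigma> v = wr \<tau> w" "\<tau> \<in> A" "int p dvd d * (\<Sum>i\<in>{1..n}. w i)"
    unfolding sum_ext_def by blast
  have "int p dvd (\<Sum>i\<in>{1..n}. v i - w i)"
    using w(1) by (intro dvd_sum) (auto simp: wr_eq_iff mod_eq_dvd_iff)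
  then have "int p dvd d * ((\<Sum>i\<in>{1..n}. v i) - (\<Sum>i\<in>{1..n}. w i))"
    by (simp add: sum_subtractf)
  from dvd_add[OF this w(3)] have "int p dvd d * (\<Sum>i\<in>{1..n}. v i)"
    by (simp add: right_diff_distrib)
  then show "\<sigma> \<in> A \<and> int p dvd d * (\<Sum>i\<in>{1..n}. v i)"
    using w by (simp add: wr_eq_iff)
qed (unfold sum_ext_def, blast)

text \<open>Permuting coordinates preserves the entry sum, so sending \<open>wr \<sigma> v\<close>
  to the sum of \<open>v\<close> modulo \<open>p\<close> is a homomorphism into an abelian group.
  The kernel of \<open>d\<close> times this map, intersected with the preimage of \<open>A\<close>,
  is \<open>sum_ext A d\<close>.\<close>

lemma sum_ext_normal:
  assumes "A \<lhd> sym_group n"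
  shows "sum_ext A d \<lhd> G"
proof -
  interpret S: group "sym_group n" by (rule sym_group_is_group)
  interpret A: subgroup A "sym_group n" using assms by (rule normal_imp_subgroup)
  have per: "\<sigma> permutes {1..n}" if "\<sigma> \<in> A" for \<sigma>
    using that A.subset by (auto simp: sym_group_carrier)
  show ?thesis
  proof (rule G.normal_invI[OF G.subgroupI])
    show "sum_ext A d \<subseteq> carrier G"
      using per by (auto simp: sum_ext_def)
    have "id \<in> A" using A.one_closed by (simp add: sym_group_one)
    then have "wr id (\<lambda>_. 0) \<in> sum_ext A d" by (simp add: wr_in_sum_ext)
    then show "sum_ext A d \<noteq> {}" by blast
  next
    fix x assume "x \<in> sum_ext A d"
    then obtain \<sigma> v where x: "x = wr \<sigma> v" "\<sigma> \<in> A" "int p dvd d * (\<Sum>i\<in>{1..n}. v i)"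
      by (auto simp: sum_ext_def)
    have "inv' \<sigma> \<in> A"
      using A.m_inv_closed[OF x(2)] per[OF x(2)] by (simp add: sym_group_carrier)
    then show "inv\<^bsub>G\<^esub> x \<in> sum_ext A d"
      using x by (simp add: wr_inv per wr_in_sum_ext sum_negf sum_permute)
  next
    fix x y assume "x \<in> sum_ext A d" "y \<in> sum_ext A d"
    then obtain \<sigma> v \<tau> w where xy: "x = wr \<sigma> v" "\<sigma> \<in> A" "int p dvd d * (\<Sum>i\<in>{1..n}. v i)"
      "y = wr \<tau> w" "\<tau> \<in> A" "int p dvd d * (\<Sum>i\<in>{1..n}. w i)"
      by (auto simp: sum_ext_def)
    have "\<sigma> \<circ> \<tau> \<in> A"
      using A.m_closed[OF xy(2,5)] by (simp add: sym_group_mult)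
    then show "x \<otimes>\<^bsub>G\<^esub> y \<in> sum_ext A d"
      using xy by (simp add: wr_mult per wr_in_sum_ext sum.distrib sum_permute permutes_inv distrib_left)
  next
    fix x y assume "x \<in> carrier G" "y \<in> sum_ext A d"
    then obtain \<sigma> v \<tau> w where xy: "x = wr \<sigma> v" "\<sigma> permutes {1..n}"
      "y = wr \<tau> w" "\<tau> \<in> A" "int p dvd d * (\<Sum>i\<in>{1..n}. w i)"
      by (auto simp: sum_ext_def carrier_G)
    have A: "\<sigma> \<circ> \<tau> \<circ> inv' \<sigma> \<in> A"
      using S.normal_invE(2)[OF assms, of \<sigma> \<tau>] xy by (simp add: sym_group_mult sym_group_carrier)
    have "(\<lambda>i. \<sigma> (inv' \<tau> (inv' \<sigma> i))) permutes {1..n}"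
      using permutes_compose[OF permutes_compose[OF permutes_inv[OF xy(2)] permutes_inv[OF per[OF xy(4)]]] xy(2)]
      by (simp add: comp_def)
    then have "(\<Sum>i\<in>{1..n}. v i + w (inv' \<sigma> i) - v (\<sigma> (inv' \<tau> (inv' \<sigma> i)))) = (\<Sum>i\<in>{1..n}. w i)"
      using xy sum_permute[of "\<lambda>i. \<sigma> (inv' \<tau> (inv' \<sigma> i))" v]
      by (simp add: sum.distrib sum_subtractf sum_permute permutes_inv)
    then show "x \<otimes>\<^bsub>G\<^esub> y \<otimes>\<^bsub>G\<^esub> inv\<^bsub>G\<^esub> x \<in> sum_ext A d"
      using xy A by (simp add: wr_conj per wr_in_sum_ext)
  qed
qed

section \<open>Closure properties of subgroups of \<open>G\<close>\<close>

lemma subgroup_wr_diff: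
  assumes "subgroup N G" "\<tau> permutes {1..n}" "wr \<tau> v \<in> N" "wr \<tau> w \<in> N"
  shows "wr id (\<lambda>i. w i - v i) \<in> N"
proof -
  have "wr \<tau> w \<otimes>\<^bsub>G\<^esub> inv\<^bsub>G\<^esub> (wr \<tau> v) \<in> N"
    using assms by (simp add: subgroup.m_closed subgroup.m_inv_closed)
  then show ?thesis using assms(2)
    by (simp add: wr_inv wr_mult permutes_inv_o permutes_inverses)
qed

lemma subgroup_wr_add:
  assumes "subgroup N G" "wr id v \<in> N" "wr \<tau> w \<in> N"
  shows "wr \<tau> (\<lambda>i. v i + w i) \<in> N"
  using subgroup.m_closed[OF assms(1-3)] by (simp add: wr_mult permutes_id)

lemma subgroup_wr_scale:
  assumes N: "subgroup N G" and v: "wr id v \<in> N"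
  shows "wr id (\<lambda>i. k * v i) \<in> N"
proof -
  have nat: "wr id (\<lambda>i. int m * v i) \<in> N" for m
  proof (induction m)
    case 0
    show "wr id (\<lambda>i. int 0 * v i) \<in> N" using subgroup.one_closed[OF N] by (simp add: one_G)
  next
    case (Suc m)
    from subgroup_wr_add[OF N v this] show ?case by (simp add: algebra_simps)
  qed
  \<comment> \<open>Natural multiples come from repeated addition; an arbitrary integer
    \<open>k\<close> is replaced by its residue modulo \<open>p\<close>.\<close>
  have "wr id (\<lambda>i. k * v i) = wr id (\<lambda>i. int (nat (k mod int p)) * v i)"
    using p_pos by (simp add: wr_eq_iff mod_mult_left_eq)
  then show ?thesis using nat by metis
qed

lemma normal_wr_conj:
  assumes N: "N \<lhd> G" and v: "wr \<tau> v \<in> N" and per: "\<tau> permutes {1..n}" "\<rho> permutes {1..n}"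
  shows "wr (\<rho> \<circ> \<tau> \<circ> inv' \<rho>) (\<lambda>i. v (inv' \<rho> i)) \<in> N"
proof -
  have "wr \<rho> (\<lambda>_. 0) \<otimes>\<^bsub>G\<^esub> wr \<tau> v \<otimes>\<^bsub>G\<^esub> inv\<^bsub>G\<^esub> (wr \<rho> (\<lambda>_. 0)) \<in> N"
    using G.normal_invE(2)[OF N wr_carrier[OF per(2)] v] .
  then show ?thesis by (simp add: wr_conj[OF per(2,1)])
qed

text \<open>This is the commutator of the base vector \<open>w\<close> with an element over
  \<open>\<tau>\<close>. Since B is abelian, the base component \<open>v\<close> cancels.\<close>

lemma normal_wr_base_commutator:
  assumes N: "N \<lhd> G" and v: "wr \<tau> v \<in> N" and per: "\<tau> permutes {1..n}"
  shows "wr id (\<lambda>i. w i - w (inv' \<tau> i)) \<in> N"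
proof -
  have "wr \<tau> (\<lambda>i. w i + v i - w (inv' \<tau> i)) \<in> N"
    using G.normal_invE(2)[OF N, of "wr id w", OF wr_carrier[OF permutes_id] v] per
    by (simp add: wr_conj permutes_id)
  from subgroup_wr_diff[OF normal_imp_subgroup[OF N] per v this] show ?thesis by (simp add: algebra_simps)
qed

lemma wr_in_centralizer:
  assumes "\<sigma> permutes {1..n}" "\<tau> permutes {1..n}"
  shows "wr \<tau> w \<in> centralizer G (wr \<sigma> v) \<longleftrightarrow> \<tau> \<circ> \<sigma> = \<sigma> \<circ> \<tau> \<and>
    (\<forall>i\<in>{1..n}. (w i + v (inv' \<tau> i)) mod int p = (v i + w (inv' \<sigma> i)) mod int p)"
  using assms by (simp add: centralizer_def wr_mult wr_eq_iff)

text \<open>With e_j the unit vectors, the differences e_j - e_1 span the sum-zero vectors: modulo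
  \<open>p\<close>, v is the sum of v_j (e_j - e_1) over j from 2 to n.\<close>

lemma sum_zero_subset:
  assumes N: "subgroup N G"
    and diff: "\<And>j. j \<in> {2..n} \<Longrightarrow> wr id (\<lambda>i. of_bool (i = j) - of_bool (i = 1)) \<in> N"
  shows "sum_ext {id} 1 \<subseteq> N"
proof
  fix x assume "x \<in> sum_ext {id} 1"
  then obtain v where x: "x = wr id v" and dvd: "int p dvd (\<Sum>i\<in>{1..n}. v i)"
    by (auto simp: sum_ext_def)
  define e :: "nat \<Rightarrow> nat \<Rightarrow> int" where "e j i = of_bool (i = j) - of_bool (i = 1)" for j i
  have *: "wr id (\<lambda>i. \<Sum>j\<in>F. v j * e j i) \<in> N" if "finite F" "F \<subseteq> {2..n}" for F
    using that
  proof (induction F rule: finite_induct)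
    case empty
    show "wr id (\<lambda>i. \<Sum>j\<in>{}. v j * e j i) \<in> N"
      using subgroup.one_closed[OF N] by (simp add: one_G)
  next
    case (insert k F)
    have "wr id (\<lambda>i. v k * e k i) \<in> N"
      using subgroup_wr_scale[OF N diff, of k "v k"] insert.prems by (simp add: e_def)
    moreover have "wr id (\<lambda>i. \<Sum>j\<in>F. v j * e j i) \<in> N"
      by (rule insert.IH) (use insert.prems in auto)
    ultimately have "wr id (\<lambda>i. v k * e k i + (\<Sum>j\<in>F. v j * e j i)) \<in> N"
      by (rule subgroup_wr_add[OF N])
    then show "wr id (\<lambda>i. \<Sum>j\<in>insert k F. v j * e j i) \<in> N"
      using insert.hyps by simp
  qed
  have "wr id v = wr id (\<lambda>i. \<Sum>j\<in>{2..n}. v j * e j i)"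
    unfolding wr_eq_iff
  proof (intro conjI ballI refl)
    fix i assume i: "i \<in> {1..n}"
    show "v i mod int p = (\<Sum>j\<in>{2..n}. v j * e j i) mod int p"
    proof (cases "i = 1")
      case True
      \<comment> \<open>At coordinate 1 the combination is minus the sum of the other entries, which
        is congruent to \<open>v 1\<close> because \<open>p\<close> divides the whole sum.\<close>
      have "(\<Sum>j\<in>{2..n}. v j * e j i) = (\<Sum>j\<in>{2..n}. - v j)"
        using True by (intro sum.cong) (auto simp: e_def)
      moreover have "(\<Sum>j\<in>{1..n}. v j) = v 1 + (\<Sum>j\<in>{2..n}. v j)"
        using i sum.atLeast_Suc_atMost[of 1 n v] by (simp add: numeral_2_eq_2 One_nat_def)
      ultimately show ?thesis using dvd True
        by (simp add: mod_eq_dvd_iff sum_negf)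
    next
      case False
      have "(\<Sum>j\<in>{2..n}. v j * e j i) = (\<Sum>j\<in>{2..n}. if j = i then v j else 0)"
        using False by (intro sum.cong) (auto simp: e_def)
      also have "\<dots> = v i" using i False by (simp add: sum.delta)
      finally show ?thesis by simp
    qed
  qed
  then show "x \<in> N" using x *[of "{2..n}"] by simp
qed

section \<open>The base group, the copy of Alt(n) and [Alt(n), B]\<close>

lemma base_group_eq: "base_group (integer_mod_group p) n = sum_ext {id} 0"
proof -
  have "base_group (integer_mod_group p) n = {x \<in> carrier G. fst x = id}"
    by (auto simp: base_group_def wreath_Sym_def semidirect_product_def sym_group_one
        sym_group_carrier permutes_id)
  also have "\<dots> = sum_ext {id} 0"
    unfolding carrier_G sum_ext_def by (auto simp: wr_def permutes_id)
  finally show ?thesis .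
qed

lemma Alt_in_wreath_eq:
  "Alt_in_wreath (integer_mod_group p) n = {wr \<alpha> (\<lambda>_. 0) |\<alpha>. \<alpha> \<in> carrier (alt_group n)}"
  by (auto simp: Alt_in_wreath_def wr_def)

lemma trivial_normal: "{id} \<lhd> sym_group n"
  using group.one_is_normal[OF sym_group_is_group[of n]] by (simp add: sym_group_one)

lemma alt_group_normal: "carrier (alt_group n) \<lhd> sym_group n"
  using group_hom.normal_kernel[OF sign_group_hom] unfolding alt_group_is_sign_kernel .

text \<open>Serves both semidirect products of the theorem: the normal factor is B for
  \<open>d = 0\<close> and consists of the sum-zero vectors for \<open>d = 1\<close>.\<close>

lemma Alt_semidirect:
  "is_internal_semidirect_product G (sum_ext (carrier (alt_group n)) d)
    (Alt_in_wreath (integer_mod_group p) n) (sum_ext {id} d)"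
  unfolding is_internal_semidirect_product_def
proof (intro conjI)
  have per: "\<alpha> permutes {1..n}" if "\<alpha> \<in> carrier (alt_group n)" for \<alpha>
    using that by (simp add: alt_group_carrier)
  have id: "id \<in> carrier (alt_group n)"
    using group.is_monoid[OF alt_group_is_group] monoid.one_closed alt_group_one by metis
  show sub: "subgroup (sum_ext (carrier (alt_group n)) d) G"
    by (rule normal_imp_subgroup[OF sum_ext_normal[OF alt_group_normal]])
  show "sum_ext {id} d \<lhd> G\<lparr>carrier := sum_ext (carrier (alt_group n)) d\<rparr>"
    by (rule G.normal_restrict_supergroup[OF sub sum_ext_normal[OF trivial_normal]])
      (use id in \<open>auto simp: sum_ext_def\<close>)
  show "subgroup (Alt_in_wreath (integer_mod_group p) n) G"
    unfolding Alt_in_wreath_eq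
  proof (rule G.subgroupI)
    fix x y assume "x \<in> {wr \<alpha> (\<lambda>_. 0) |\<alpha>. \<alpha> \<in> carrier (alt_group n)}"
      "y \<in> {wr \<alpha> (\<lambda>_. 0) |\<alpha>. \<alpha> \<in> carrier (alt_group n)}"
    then obtain \<alpha> \<beta> where *: "x = wr \<alpha> (\<lambda>_. 0)" "\<alpha> \<in> carrier (alt_group n)"
      "y = wr \<beta> (\<lambda>_. 0)" "\<beta> \<in> carrier (alt_group n)" by blast
    then have "x \<otimes>\<^bsub>G\<^esub> y = wr (\<alpha> \<circ> \<beta>) (\<lambda>_. 0)" "inv\<^bsub>G\<^esub> x = wr (inv' \<alpha>) (\<lambda>_. 0)"
      by (simp_all add: wr_mult wr_inv per)
    moreover have "\<alpha> \<circ> \<beta> \<in> carrier (alt_group n)"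
      using group.is_monoid[OF alt_group_is_group] monoid.m_closed *(2,4) alt_group_mult by metis
    ultimately show "x \<otimes>\<^bsub>G\<^esub> y \<in> {wr \<alpha> (\<lambda>_. 0) |\<alpha>. \<alpha> \<in> carrier (alt_group n)}"
      "inv\<^bsub>G\<^esub> x \<in> {wr \<alpha> (\<lambda>_. 0) |\<alpha>. \<alpha> \<in> carrier (alt_group n)}"
      using alt_group_inv_closed[OF *(2)] by blast+
  next
    show "{wr \<alpha> (\<lambda>_. 0) |\<alpha>. \<alpha> \<in> carrier (alt_group n)} \<subseteq> carrier G" using per by auto
    show "{wr \<alpha> (\<lambda>_. 0) |\<alpha>. \<alpha> \<in> carrier (alt_group n)} \<noteq> {}" using id by blast
  qed
  show "Alt_in_wreath (integer_mod_group p) n \<inter> sum_ext {id} d = {\<one>\<^bsub>G\<^esub>}"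
  proof
    show "Alt_in_wreath (integer_mod_group p) n \<inter> sum_ext {id} d \<subseteq> {\<one>\<^bsub>G\<^esub>}"
      by (auto simp: Alt_in_wreath_eq wr_in_sum_ext one_G)
    have "\<one>\<^bsub>G\<^esub> \<in> sum_ext {id} d" by (simp add: one_G wr_in_sum_ext)
    moreover have "\<one>\<^bsub>G\<^esub> \<in> Alt_in_wreath (integer_mod_group p) n"
      using id unfolding Alt_in_wreath_eq one_G by blast
    ultimately show "{\<one>\<^bsub>G\<^esub>} \<subseteq> Alt_in_wreath (integer_mod_group p) n \<inter> sum_ext {id} d" by blast
  qed
  show "sum_ext (carrier (alt_group n)) d =
    Alt_in_wreath (integer_mod_group p) n <#>\<^bsub>G\<^esub> sum_ext {id} d"
  proof
    show "sum_ext (carrier (alt_group n)) d \<subseteq>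
      Alt_in_wreath (integer_mod_group p) n <#>\<^bsub>G\<^esub> sum_ext {id} d"
    proof
      fix x assume "x \<in> sum_ext (carrier (alt_group n)) d"
      then obtain \<alpha> v where x: "x = wr \<alpha> v" "\<alpha> \<in> carrier (alt_group n)"
        "int p dvd d * (\<Sum>i\<in>{1..n}. v i)" unfolding sum_ext_def by blast
      \<comment> \<open>In \<open>wr \<alpha> v\<close> the base component stands to the left of the
        permutation, whereas the product set has the Alt(n) factor on the left. Swapping them
        replaces \<open>v\<close> by its composite with \<open>\<alpha>\<close>.\<close>
      have "x = wr \<alpha> (\<lambda>_. 0) \<otimes>\<^bsub>G\<^esub> wr id (\<lambda>i. v (\<alpha> i))"
        using x per[OF x(2)] by (simp add: wr_mult permutes_inverses)
      moreover have "wr id (\<lambda>i. v (\<alpha> i)) \<in> sum_ext {id} d"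
        using x sum_permute[OF per[OF x(2)], of v] by (simp add: wr_in_sum_ext)
      ultimately show "x \<in> Alt_in_wreath (integer_mod_group p) n <#>\<^bsub>G\<^esub> sum_ext {id} d"
        using x(2) unfolding set_mult_def Alt_in_wreath_eq by blast
    qed
    have "wr \<alpha> (\<lambda>_. 0) \<otimes>\<^bsub>G\<^esub> wr id v \<in> sum_ext (carrier (alt_group n)) d"
      if "\<alpha> \<in> carrier (alt_group n)" "int p dvd d * (\<Sum>i\<in>{1..n}. v i)" for \<alpha> v
      using that per[OF that(1)] sum_permute[OF permutes_inv[OF per[OF that(1)]], of v]
      by (simp add: wr_mult wr_in_sum_ext)
    then show "Alt_in_wreath (integer_mod_group p) n <#>\<^bsub>G\<^esub> sum_ext {id} d \<subseteq>
      sum_ext (carrier (alt_group n)) d"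
      unfolding set_mult_def Alt_in_wreath_eq sum_ext_def[of "{id}"] by blast
  qed
qed

text \<open>The commutators are the vectors v - v \<circ> \<alpha>, which have sum zero. Conversely,
  a 3-cycle taking 1 to j and the unit vector at j give e_j - e_1.\<close>

lemma commutator_subgroup_eq:
  assumes n: "n \<ge> 3"
  shows "commutator_subgroup G (Alt_in_wreath (integer_mod_group p) n)
    (base_group (integer_mod_group p) n) = sum_ext {id} 1"
proof -
  define C where "C = {inv\<^bsub>G\<^esub> x \<otimes>\<^bsub>G\<^esub> inv\<^bsub>G\<^esub> y \<otimes>\<^bsub>G\<^esub> x \<otimes>\<^bsub>G\<^esub> y | x y.
    x \<in> Alt_in_wreath (integer_mod_group p) n \<and> y \<in> base_group (integer_mod_group p) n}"
  have comm: "inv\<^bsub>G\<^esub> (wr \<alpha> (\<lambda>_. 0)) \<otimes>\<^bsub>G\<^esub> inv\<^bsub>G\<^esub> (wr id v) \<otimes>\<^bsub>G\<^esub> wr \<alpha> (\<lambda>_. 0) \<otimes>\<^bsub>G\<^esub> wr id v =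
    wr id (\<lambda>i. v i - v (\<alpha> i))" if "\<alpha> permutes {1..n}" for \<alpha> v
    using that by (simp add: wr_inv wr_mult permutes_inv permutes_id permutes_inv_o permutes_inv_inv)
  have C: "C = {wr id (\<lambda>i. v i - v (\<alpha> i)) |\<alpha> v. \<alpha> \<in> carrier (alt_group n)}"
  proof (intro equalityI subsetI)
    fix c assume "c \<in> C"
    then obtain x y where c: "c = inv\<^bsub>G\<^esub> x \<otimes>\<^bsub>G\<^esub> inv\<^bsub>G\<^esub> y \<otimes>\<^bsub>G\<^esub> x \<otimes>\<^bsub>G\<^esub> y"
      "x \<in> Alt_in_wreath (integer_mod_group p) n" "y \<in> base_group (integer_mod_group p) n"
      unfolding C_def by blast
    obtain \<alpha> where \<alpha>: "x = wr \<alpha> (\<lambda>_. 0)" "\<alpha> \<in> carrier (alt_group n)"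
      using c(2) unfolding Alt_in_wreath_eq by blast
    obtain v where "y = wr id v" using c(3) by (auto simp: base_group_eq sum_ext_def)
    then have "c = wr id (\<lambda>i. v i - v (\<alpha> i))"
      using c(1) \<alpha> comm by (simp add: alt_group_carrier)
    then show "c \<in> {wr id (\<lambda>i. v i - v (\<alpha> i)) |\<alpha> v. \<alpha> \<in> carrier (alt_group n)}"
      using \<alpha>(2) by blast
  next
    fix c assume "c \<in> {wr id (\<lambda>i. v i - v (\<alpha> i)) |\<alpha> v. \<alpha> \<in> carrier (alt_group n)}"
    then obtain \<alpha> v where c: "c = wr id (\<lambda>i. v i - v (\<alpha> i))" "\<alpha> \<in> carrier (alt_group n)" by blast
    have "wr \<alpha> (\<lambda>_. 0) \<in> Alt_in_wreath (integer_mod_group p) n"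
      unfolding Alt_in_wreath_eq using c(2) by blast
    moreover have "wr id v \<in> base_group (integer_mod_group p) n"
      by (simp add: base_group_eq wr_in_sum_ext)
    moreover have "c = inv\<^bsub>G\<^esub> (wr \<alpha> (\<lambda>_. 0)) \<otimes>\<^bsub>G\<^esub> inv\<^bsub>G\<^esub> (wr id v) \<otimes>\<^bsub>G\<^esub> wr \<alpha> (\<lambda>_. 0) \<otimes>\<^bsub>G\<^esub> wr id v"
      using comm c by (simp add: alt_group_carrier)
    ultimately show "c \<in> C" unfolding C_def by blast
  qed
  have carr: "C \<subseteq> carrier G" unfolding C by (auto simp: permutes_id)
  have sub: "subgroup (sum_ext {id} 1) G"
    by (rule normal_imp_subgroup[OF sum_ext_normal[OF trivial_normal]])
  have "C \<subseteq> sum_ext {id} 1"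
  proof
    fix x assume "x \<in> C"
    then obtain \<alpha> v where x: "x = wr id (\<lambda>i. v i - v (\<alpha> i))" "\<alpha> permutes {1..n}"
      unfolding C alt_group_carrier by blast
    show "x \<in> sum_ext {id} 1"
      unfolding x(1) wr_in_sum_ext using sum_permute[OF x(2), of v] by (simp add: sum_subtractf)
  qed
  then have "generate G C \<subseteq> sum_ext {id} 1" by (rule G.generate_subgroup_incl[OF _ sub])
  moreover have "sum_ext {id} 1 \<subseteq> generate G C"
  proof (rule sum_zero_subset[OF G.generate_is_subgroup[OF carr]])
    fix j assume j: "j \<in> {2..n}"
    \<comment> \<open>The transposition of 1 and \<open>j\<close> is odd, so a third point is used
      to form an even permutation taking 1 to \<open>j\<close>.\<close>
    obtain e where e: "e \<in> {1..n}" "e \<noteq> 1" "e \<noteq> j"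
    proof (cases "j = 2")
      case True then show ?thesis using n that[of 3] by simp
    next
      case False then show ?thesis using n that[of 2] by simp
    qed
    define \<alpha> where "\<alpha> = cycle_of_list [1, j, e]"
    have "\<alpha> \<in> three_cycles n"
      using j e n unfolding \<alpha>_def by (intro CollectI exI[of _ "[1, j, e]"]) auto
    then have \<alpha>: "\<alpha> \<in> carrier (alt_group n)" using three_cycles_incl by blast
    then have inj: "inj \<alpha>" using permutes_inj by (auto simp: alt_group_carrier)
    have "\<alpha> 1 = j" using j e by (simp add: \<alpha>_def transpose_def)
    then have iff: "\<alpha> i = j \<longleftrightarrow> i = 1" for i using inj by (auto simp: inj_eq)
    have "wr id (\<lambda>i. of_bool (i = j) - of_bool (\<alpha> i = j)) \<in> C"
      unfolding C using \<alpha>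
      by (intro CollectI exI[of _ \<alpha>] exI[of _ "\<lambda>i. of_bool (i = j)"] conjI refl)
    then show "wr id (\<lambda>i. of_bool (i = j) - of_bool (i = 1)) \<in> generate G C"
      unfolding iff by (rule generate.incl)
  qed
  ultimately show ?thesis unfolding commutator_subgroup_def C_def by blast
qed

end

section \<open>The pseudocentre of the wreath product\<close>

lemma pseudocentre_subset:
  assumes "x \<in> carrier G" "N \<lhd> G" "centralizer G x \<subseteq> N"
  shows "pseudocentre G \<subseteq> N"
  using assms unfolding pseudocentre_def normal_closure_def by blast

lemma subset_pseudocentre:
  assumes "\<And>x N. x \<in> carrier G \<Longrightarrow> N \<lhd> G \<Longrightarrow> centralizer G x \<subseteq> N \<Longrightarrow> S \<subseteq> N"
  shows "S \<subseteq> pseudocentre G"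
  using assms unfolding pseudocentre_def normal_closure_def by blast

locale prime_wreath =
  fixes n p :: nat
  assumes n_ge_3: "n \<ge> 3" and prime_p: "Factorial_Ring.prime p"
begin

sublocale cyclic_wreath n p
  by unfold_locales (rule prime_gt_0_nat[OF prime_p])

lemma not_dvd_1: "\<not> int p dvd 1"
  using prime_gt_1_nat[OF prime_p] by auto

text \<open>A vector and its image under the transposition of \<open>a\<close> and \<open>b\<close>
  differ by (v a - v b)(e_a - e_b). The scalar is invertible modulo the prime \<open>p\<close>, and
  by double transitivity e_a - e_b is conjugate to every e_j - e_1.\<close>

lemma sum_zero_subset_normal:
  assumes N: "N \<lhd> G" and v: "wr id v \<in> N"
    and ab: "a \<in> {1..n}" "b \<in> {1..n}" "\<not> int p dvd v a - v b"
  shows "sum_ext {id} 1 \<subseteq> N"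
proof -
  have sub: "subgroup N G" by (rule normal_imp_subgroup[OF N])
  have neq: "a \<noteq> b" using ab(3) by auto
  define t where "t = transpose a b"
  have t: "t permutes {1..n}" using ab by (simp add: t_def permutes_swap_id)
  have "wr (t \<circ> id \<circ> inv' t) (\<lambda>i. v (inv' t i)) \<in> N"
    by (rule normal_wr_conj[OF N v permutes_id t])
  then have "wr id (\<lambda>i. v (t i)) \<in> N"
    using permutes_inv_o(1)[OF t] by (simp add: t_def)
  from subgroup_wr_diff[OF sub permutes_id this v] have diff: "wr id (\<lambda>i. v i - v (t i)) \<in> N" .
  define c where "c = v a - v b"
  have "coprime c (int p)"
    using prime_imp_coprime[of "int p" c] prime_p ab(3) by (simp add: c_def coprime_commute)
  \<comment> \<open>Here \<open>k\<close> is an inverse of \<open>c\<close> modulo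
    \<open>p\<close>.\<close>
  then obtain k l where kl: "k * c + l * int p = 1"
    using bezout_int[of c "int p"] by (auto simp: coprime_iff_gcd_eq_1)
  have "wr id (\<lambda>i. k * (v i - v (t i))) = wr id (\<lambda>i. of_bool (i = a) - of_bool (i = b))"
    unfolding wr_eq_iff mod_eq_dvd_iff
  proof (intro conjI ballI refl)
    fix i
    have "k * (v i - v (t i)) - (of_bool (i = a) - of_bool (i = b)) =
      - (of_bool (i = a) - of_bool (i = b)) * (l * int p)"
    proof -
      have 1: "l * int p = 1 - k * c" using kl by simp
      show ?thesis unfolding 1 using neq by (auto simp: t_def transpose_def c_def algebra_simps)
    qed
    then show "int p dvd k * (v i - v (t i)) - (of_bool (i = a) - of_bool (i = b))" by simp
  qed
  with subgroup_wr_scale[OF sub diff, of k]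
  have ab_in: "wr id (\<lambda>i. of_bool (i = a) - of_bool (i = b)) \<in> N" by simp
  show ?thesis
  proof (rule sum_zero_subset[OF sub])
    fix j assume j: "j \<in> {2..n}"
    obtain \<rho> where \<rho>: "\<rho> permutes {1..n}" "map \<rho> [a, b] = [j, 1]"
      using permutes_map_list_exists[of "[a, b]" "[j, 1]" "{1..n}"] ab neq j n_ge_3 by auto
    have "wr (\<rho> \<circ> id \<circ> inv' \<rho>) (\<lambda>i. of_bool (inv' \<rho> i = a) - of_bool (inv' \<rho> i = b)) \<in> N"
      by (rule normal_wr_conj[OF N ab_in permutes_id \<rho>(1)])
    moreover have "\<rho> \<circ> id \<circ> inv' \<rho> = id" using permutes_inv_o(1)[OF \<rho>(1)] by simp
    moreover have "inv' \<rho> i = a \<longleftrightarrow> i = j" "inv' \<rho> i = b \<longleftrightarrow> i = 1" for i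
      using permutes_inv_eq[OF \<rho>(1)] \<rho>(2) by auto
    ultimately show "wr id (\<lambda>i. of_bool (i = j) - of_bool (i = 1)) \<in> N" by simp
  qed
qed

section \<open>Lower bounds: normal subgroups containing the centralizer of \<open>x\<close>\<close>

context
  fixes x N
  assumes x: "x \<in> carrier G" and N: "N \<lhd> G" and cent: "centralizer G x \<subseteq> N"
begin

lemma N_subgroup: "subgroup N G"
  by (rule normal_imp_subgroup[OF N])

lemma x_in_N: "x \<in> N"
  using x cent by (auto simp: centralizer_def)

lemma sum_zero_in_N: "sum_ext {id} 1 \<subseteq> N"
proof -
  obtain \<sigma> v where xv: "x = wr \<sigma> v" and \<sigma>: "\<sigma> permutes {1..n}"
    using x by (auto simp: carrier_G)
  show ?thesis
  proof (cases "\<sigma> = id")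
    case True
    have "wr id (\<lambda>i. of_bool (i = 1)) \<in> centralizer G x"
      unfolding xv True wr_in_centralizer[OF permutes_id permutes_id] by (simp add: add.commute)
    then have "wr id (\<lambda>i. of_bool (i = 1)) \<in> N" using cent by blast
    then show ?thesis
      by (rule sum_zero_subset_normal[OF N, of _ 1 2]) (use n_ge_3 not_dvd_1 in auto)
  next
    case False
    then obtain a where a: "\<sigma> a \<noteq> a" by (auto simp: fun_eq_iff)
    then have a_in: "a \<in> {1..n}" using \<sigma> by (auto simp: permutes_def)
    then have b_in: "\<sigma> a \<in> {1..n}" using permutes_in_image[OF \<sigma>] by blast
    \<comment> \<open>The commutator below has entries 1 at \<open>a\<close> and -1 at
      \<open>\<sigma> a\<close>, which coincide if \<open>p = 2\<close>. It is therefore compared at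
      \<open>a\<close> and a third coordinate \<open>e\<close>, where it vanishes.\<close>
    have "card {a, \<sigma> a} < card {1..n}" using n_ge_3 a by simp
    then obtain e where e: "e \<in> {1..n}" "e \<notin> {a, \<sigma> a}"
      by (metis card_mono finite.emptyI finite_insert leD subsetI)
    have "wr id (\<lambda>i. of_bool (i = a) - of_bool (inv' \<sigma> i = a)) \<in> N"
      by (rule normal_wr_base_commutator[OF N _ \<sigma>]) (use x_in_N xv in simp)
    then have "wr id (\<lambda>i. of_bool (i = a) - of_bool (i = \<sigma> a)) \<in> N"
      using permutes_inv_eq[OF \<sigma>] by (simp add: eq_commute)
    then show ?thesis
      by (rule sum_zero_subset_normal[OF N _ a_in e(1)]) (use a e not_dvd_1 in auto)
  qed
qed

text \<open>A constant vector commutes with every element of \<open>G\<close>. Subtracting the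
  constant s/n from a vector with entry sum s, where 1/n is taken modulo \<open>p\<close>, leaves a
  sum-zero vector.\<close>

lemma base_in_N:
  assumes "\<not> p dvd n"
  shows "sum_ext {id} 0 \<subseteq> N"
proof
  obtain \<sigma> u where xu: "x = wr \<sigma> u" and \<sigma>: "\<sigma> permutes {1..n}"
    using x by (auto simp: carrier_G)
  fix y assume "y \<in> sum_ext {id} 0"
  then obtain v where y: "y = wr id v" by (auto simp: sum_ext_def)
  define s where "s = (\<Sum>i\<in>{1..n}. v i)"
  have "coprime (int n) (int p)"
    using prime_imp_coprime[of p n] prime_p assms by (simp add: coprime_commute)
  then obtain k l where kl: "k * int n + l * int p = 1"
    using bezout_int[of "int n" "int p"] by (auto simp: coprime_iff_gcd_eq_1)
  have "wr id (\<lambda>_. s * k) \<in> centralizer G x"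
    unfolding xu wr_in_centralizer[OF \<sigma> permutes_id] by (simp add: add.commute)
  then have const: "wr id (\<lambda>_. s * k) \<in> N" using cent by blast
  have "(\<Sum>i\<in>{1..n}. v i - s * k) = s * (l * int p)"
  proof -
    have 1: "l * int p = 1 - k * int n" using kl by simp
    show ?thesis unfolding 1 by (simp add: sum_subtractf s_def algebra_simps)
  qed
  then have "wr id (\<lambda>i. v i - s * k) \<in> sum_ext {id} 1" by (simp add: wr_in_sum_ext)
  then have "wr id (\<lambda>i. v i - s * k) \<in> N" using sum_zero_in_N by blast
  from subgroup_wr_add[OF N_subgroup const this] show "y \<in> N" by (simp add: y)
qed

lemma wr_sum_zero_in_N:
  assumes "wr \<tau> v \<in> N" "(\<Sum>i\<in>{1..n}. v i) = 0"
  shows "wr \<tau> (\<lambda>_. 0) \<in> N"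
proof -
  have "wr id (\<lambda>i. - v i) \<in> sum_ext {id} 1" using assms(2) by (simp add: wr_in_sum_ext sum_negf)
  then have "wr id (\<lambda>i. - v i) \<in> N" using sum_zero_in_N by blast
  from subgroup_wr_add[OF N_subgroup this assms(1)] show ?thesis by simp
qed

text \<open>The commutator with t = (y z) is the product of the given element and a conjugate of its
  inverse. Its base component is \<open>w\<close> minus a rearrangement of \<open>w\<close>, so it
  has sum zero and can be removed inside \<open>N\<close>.\<close>

lemma transpose_commutator_in_N:
  assumes \<tau>: "\<tau> permutes {1..n}" "wr \<tau> w \<in> N" and yz: "y \<in> {1..n}" "z \<in> {1..n}"
  shows "wr (transpose (\<tau> y) (\<tau> z) \<circ> transpose y z) (\<lambda>_. 0) \<in> N"
proof -
  define t where "t = transpose y z"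
  have t: "t permutes {1..n}" and inv_t: "inv' t = t"
    using yz by (simp_all add: t_def permutes_swap_id)
  have "inv\<^bsub>G\<^esub> (wr \<tau> w) \<in> N" by (rule subgroup.m_inv_closed[OF N_subgroup \<tau>(2)])
  then have "wr (inv' \<tau>) (\<lambda>i. - w (\<tau> i)) \<in> N" by (simp add: wr_inv \<tau>(1))
  then have "wr (t \<circ> inv' \<tau> \<circ> inv' t) (\<lambda>i. - w (\<tau> (inv' t i))) \<in> N"
    by (rule normal_wr_conj[OF N _ permutes_inv[OF \<tau>(1)] t])
  from subgroup.m_closed[OF N_subgroup \<tau>(2) this]
  have "wr (\<tau> \<circ> (t \<circ> inv' \<tau> \<circ> t)) (\<lambda>i. w i - w (\<tau> (t (inv' \<tau> i)))) \<in> N"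
    by (simp add: wr_mult \<tau>(1) inv_t)
  moreover have "(\<Sum>i\<in>{1..n}. w i - w (\<tau> (t (inv' \<tau> i)))) = 0"
  proof -
    have "(\<lambda>i. \<tau> (t (inv' \<tau> i))) permutes {1..n}"
      using permutes_compose[OF permutes_compose[OF permutes_inv[OF \<tau>(1)] t] \<tau>(1)]
      by (simp add: comp_def)
    from sum_permute[OF this, of w] show ?thesis by (simp add: sum_subtractf)
  qed
  ultimately have "wr (\<tau> \<circ> (t \<circ> inv' \<tau> \<circ> t)) (\<lambda>_. 0) \<in> N" by (rule wr_sum_zero_in_N)
  moreover have "\<tau> \<circ> (t \<circ> inv' \<tau> \<circ> t) = transpose (\<tau> y) (\<tau> z) \<circ> transpose y z"
  proof
    fix i
    have "\<tau> (transpose y z j) = transpose (\<tau> y) (\<tau> z) (\<tau> j)" for j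
      using permutes_inj[OF \<tau>(1)] by (auto simp: transpose_def inj_eq)
    then show "(\<tau> \<circ> (t \<circ> inv' \<tau> \<circ> t)) i = (transpose (\<tau> y) (\<tau> z) \<circ> transpose y z) i"
      using permutes_inverses[OF \<tau>(1)] by (simp add: t_def)
  qed
  ultimately show ?thesis by simp
qed

text \<open>
  If \<open>\<sigma>\<close> has an orbit of length at least 3, then \<open>x\<close> itself has a 3-cycle among its commutators.
  Otherwise \<open>C(x)\<close> contains an element over a transposition: the restriction of \<open>x\<close> to an orbit of
  length 2, or, if \<open>\<sigma> = 1\<close>, the transposition of two equal entries.
\<close>

lemma three_cycle_in_N:
  assumes "p < n"
  shows "\<exists>a b c. {a, b, c} \<subseteq> {1..n} \<and> distinct [a, b, c] \<and>
    wr (cycle_of_list [a, b, c]) (\<lambda>_. 0) \<in> N"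
proof -
  obtain \<sigma> v where xv: "x = wr \<sigma> v" and \<sigma>: "\<sigma> permutes {1..n}"
    using x by (auto simp: carrier_G)
  show ?thesis
  proof (cases "\<exists>a. \<sigma> (\<sigma> a) \<noteq> a")
    case True
    then obtain a where a: "\<sigma> (\<sigma> a) \<noteq> a" by blast
    \<comment> \<open>The commutator with (b c) is (c d)(b c). Only \<open>b\<close>,
      \<open>c\<close>, \<open>d\<close> have to be distinct; on an orbit of length 3,
      \<open>d\<close> equals \<open>a\<close>.\<close>
    define b c d where bcd: "b = \<sigma> a" "c = \<sigma> b" "d = \<sigma> c"
    have inj: "inj \<sigma>" by (rule permutes_inj[OF \<sigma>])
    have "a \<in> {1..n}"
      using a permutes_not_in[OF \<sigma>, of a] by (cases "a \<in> {1..n}") simp_all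
    then have mem: "b \<in> {1..n}" "c \<in> {1..n}" "d \<in> {1..n}"
      unfolding bcd by (simp_all only: permutes_in_image[OF \<sigma>])
    have "\<sigma> a \<noteq> a" using a by auto
    then have "c \<noteq> b" "d \<noteq> c" "d \<noteq> b"
      using a by (simp_all add: bcd inj_eq[OF inj])
    moreover have "wr (transpose c d \<circ> transpose b c) (\<lambda>_. 0) \<in> N"
      using transpose_commutator_in_N[OF \<sigma> _ mem(1,2)] x_in_N by (simp add: xv bcd)
    then have "wr (cycle_of_list [d, c, b]) (\<lambda>_. 0) \<in> N"
      by (simp add: transpose_commute)
    ultimately show ?thesis using mem by (intro exI[of _ d] exI[of _ c] exI[of _ b]) auto
  next
    case False
    then have invol: "\<sigma> (\<sigma> i) = i" for i by blast
    have inv_\<sigma>: "inv' \<sigma> = \<sigma>"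
      using invol by (intro inv_equality) auto
    have "\<exists>a b w. a \<in> {1..n} \<and> b \<in> {1..n} \<and> a \<noteq> b \<and> wr (transpose a b) w \<in> centralizer G x"
    proof (cases "\<sigma> = id")
      case True
      \<comment> \<open>Pigeonhole: there are more coordinates than residues modulo
        \<open>p\<close>.\<close>
      have "\<not> inj_on (\<lambda>i. v i mod int p) {1..n}"
      proof
        assume "inj_on (\<lambda>i. v i mod int p) {1..n}"
        then have "card {1..n} \<le> card {0..<int p}"
          by (rule card_inj_on_le) (use p_pos in auto)
        then show False using assms by simp
      qed
      then obtain a b where ab: "a \<in> {1..n}" "b \<in> {1..n}" "a \<noteq> b" "v a mod int p = v b mod int p"
        by (auto simp: inj_on_def)
      have "wr (transpose a b) (\<lambda>_. 0) \<in> centralizer G x"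
        unfolding xv True wr_in_centralizer[OF permutes_id permutes_swap_id[OF ab(1,2)]]
        using ab(4) by (auto simp: transpose_def)
      then show ?thesis using ab(1-3) by (intro exI conjI)
    next
      case False
      then obtain a where a: "\<sigma> a \<noteq> a" by (auto simp: fun_eq_iff)
      then have a_in: "a \<in> {1..n}" using \<sigma> by (auto simp: permutes_def)
      then have b_in: "\<sigma> a \<in> {1..n}" using permutes_in_image[OF \<sigma>] by blast
      define w where "w i = (if i = a \<or> i = \<sigma> a then v i else 0)" for i
      have iff: "\<sigma> i = a \<longleftrightarrow> i = \<sigma> a" "\<sigma> i = \<sigma> a \<longleftrightarrow> i = a" for i
        using invol by metis+
      have "wr (transpose a (\<sigma> a)) w \<in> centralizer G x"
        unfolding xv wr_in_centralizer[OF \<sigma> permutes_swap_id[OF a_in b_in]] inv_\<sigma>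
      proof (intro conjI ballI)
        show "transpose a (\<sigma> a) \<circ> \<sigma> = \<sigma> \<circ> transpose a (\<sigma> a)"
          using invol by (auto simp: fun_eq_iff transpose_def iff)
        fix i
        \<comment> \<open>On the orbit of \<open>a\<close> both sides are
          \<open>v i + v (\<sigma> i)\<close>; elsewhere both are \<open>v i\<close>.\<close>
        have "w i + v (transpose a (\<sigma> a) i) = v i + w (\<sigma> i)"
          using a invol by (auto simp: w_def transpose_def iff)
        then show "(w i + v (inv' (transpose a (\<sigma> a)) i)) mod int p = (v i + w (\<sigma> i)) mod int p"
          by simp
      qed
      then show ?thesis using not_sym[OF a] a_in b_in by (intro exI conjI)
    qed
    then obtain a b w where ab: "a \<in> {1..n}" "b \<in> {1..n}" "a \<noteq> b"
      and "wr (transpose a b) w \<in> centralizer G x" by blast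
    then have in_N: "wr (transpose a b) w \<in> N" using cent by blast
    have "card {a, b} < card {1..n}" using n_ge_3 ab by simp
    then obtain e where e: "e \<in> {1..n}" "e \<notin> {a, b}"
      by (metis card_mono finite.emptyI finite_insert leD subsetI)
    \<comment> \<open>The commutator with (b e): the transposition (a b) sends \<open>b\<close> to
      \<open>a\<close> and fixes \<open>e\<close>, so the product is (a e)(b e).\<close>
    have "wr (transpose a e \<circ> transpose b e) (\<lambda>_. 0) \<in> N"
      using transpose_commutator_in_N[OF permutes_swap_id[OF ab(1,2)] in_N ab(2) e(1)] e
      by (simp add: transpose_def)
    then have "wr (cycle_of_list [a, e, b]) (\<lambda>_. 0) \<in> N"
      by (simp add: transpose_commute)
    then show ?thesis using ab e by (intro exI[of _ a] exI[of _ e] exI[of _ b]) auto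
  qed
qed

text \<open>The permutations \<open>\<tau>\<close> for which \<open>N\<close> contains
  \<open>wr \<tau> (\<lambda>_. 0)\<close> form a normal subgroup of Sym(n), and this subgroup
  contains a 3-cycle.\<close>

lemma alt_in_N:
  assumes "p < n" "\<alpha> \<in> carrier (alt_group n)"
  shows "wr \<alpha> (\<lambda>_. 0) \<in> N"
proof -
  define L where "L = {\<tau>. \<tau> permutes {1..n} \<and> wr \<tau> (\<lambda>_. 0) \<in> N}"
  interpret S: group "sym_group n" by (rule sym_group_is_group)
  have L: "L \<lhd> sym_group n"
  proof (rule S.normal_invI[OF S.subgroupI])
    show "L \<subseteq> carrier (sym_group n)" by (auto simp: L_def sym_group_carrier)
    have "id \<in> L" using subgroup.one_closed[OF N_subgroup] by (simp add: L_def one_G permutes_id)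
    then show "L \<noteq> {}" by blast
  next
    fix \<tau> assume \<tau>: "\<tau> \<in> L"
    then have "inv\<^bsub>G\<^esub> (wr \<tau> (\<lambda>_. 0)) \<in> N"
      using subgroup.m_inv_closed[OF N_subgroup] by (simp add: L_def)
    then show "inv\<^bsub>sym_group n\<^esub> \<tau> \<in> L"
      using \<tau> by (simp add: L_def wr_inv permutes_inv sym_group_carrier)
  next
    fix \<tau> \<rho> assume *: "\<tau> \<in> L" "\<rho> \<in> L"
    then have "wr \<tau> (\<lambda>_. 0) \<otimes>\<^bsub>G\<^esub> wr \<rho> (\<lambda>_. 0) \<in> N"
      using subgroup.m_closed[OF N_subgroup] by (simp add: L_def)
    then show "\<tau> \<otimes>\<^bsub>sym_group n\<^esub> \<rho> \<in> L"
      using * by (simp add: L_def wr_mult permutes_compose sym_group_mult)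
  next
    fix \<rho> \<tau> assume *: "\<rho> \<in> carrier (sym_group n)" "\<tau> \<in> L"
    then have "wr (\<rho> \<circ> \<tau> \<circ> inv' \<rho>) (\<lambda>_. 0) \<in> N"
      using normal_wr_conj[OF N, of \<tau> "\<lambda>_. 0" \<rho>] by (simp add: L_def sym_group_carrier)
    then show "\<rho> \<otimes>\<^bsub>sym_group n\<^esub> \<tau> \<otimes>\<^bsub>sym_group n\<^esub> inv\<^bsub>sym_group n\<^esub> \<rho> \<in> L"
      using * by (simp add: L_def permutes_compose permutes_inv sym_group_mult sym_group_carrier)
  qed
  obtain a b c where abc: "{a, b, c} \<subseteq> {1..n}" "distinct [a, b, c]"
    "wr (cycle_of_list [a, b, c]) (\<lambda>_. 0) \<in> N" using three_cycle_in_N[OF assms(1)] by blast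
  have "set [a, b, c] \<subseteq> {1..n}" using abc(1) by simp
  then have "cycle_of_list [a, b, c] permutes {1..n}"
    by (rule permutes_subset[OF cycle_permutes])
  then have "cycle_of_list [a, b, c] \<in> L" unfolding L_def using abc(3) by blast
  from alt_group_subset_normal[OF L this abc(2,1)] show ?thesis
    using assms(2) by (auto simp: L_def)
qed

lemma alt_sum_ext_in_N:
  assumes "p < n" "sum_ext {id} d \<subseteq> N"
  shows "sum_ext (carrier (alt_group n)) d \<subseteq> N"
proof
  fix y assume "y \<in> sum_ext (carrier (alt_group n)) d"
  then obtain \<alpha> v where y: "y = wr \<alpha> v" "\<alpha> \<in> carrier (alt_group n)"
    "int p dvd d * (\<Sum>i\<in>{1..n}. v i)" unfolding sum_ext_def by blast
  have "wr id v \<in> N" using y(3) assms(2) wr_in_sum_ext by blast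
  from subgroup_wr_add[OF N_subgroup this alt_in_N[OF assms(1) y(2)]]
  show "y \<in> N" by (simp add: y(1))
qed

end

section \<open>Upper bounds from particular centralizers\<close>

lemma pseudocentre_subset_base:
  assumes "n \<le> p"
  shows "pseudocentre G \<subseteq> sum_ext {id} 0"
proof (rule pseudocentre_subset[OF wr_carrier[OF permutes_id] sum_ext_normal[OF trivial_normal]])
  \<comment> \<open>The vector \<open>int\<close> has entry i at coordinate i, and these entries are
    distinct modulo \<open>p\<close> since \<open>n \<le> p\<close>. A commuting element must lie
    over a permutation preserving the entries, hence over the identity.\<close>
  show "centralizer G (wr id int) \<subseteq> sum_ext {id} 0"
  proof
    fix y assume y: "y \<in> centralizer G (wr id int)"
    then obtain \<tau> w where \<tau>: "y = wr \<tau> w" "\<tau> permutes {1..n}"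
      by (auto simp: centralizer_def carrier_G)
    have "inv' \<tau> i = i" for i
    proof (cases "i \<in> {1..n}")
      case True
      have "(w i + int (inv' \<tau> i)) mod int p = (int i + w i) mod int p"
        using y True unfolding \<tau>(1) wr_in_centralizer[OF permutes_id \<tau>(2)] by simp
      then have "int p dvd int (inv' \<tau> i) - int i"
        by (simp add: mod_eq_dvd_iff algebra_simps)
      moreover have "inv' \<tau> i \<in> {1..n}"
        using True permutes_in_image[OF permutes_inv[OF \<tau>(2)]] by blast
      then have "\<bar>int (inv' \<tau> i) - int i\<bar> < int p" using True assms by auto
      ultimately show ?thesis using dvd_imp_le_int[of "int (inv' \<tau> i) - int i" "int p"] by force
    qed (rule permutes_not_in[OF permutes_inv[OF \<tau>(2)]])
    then have "inv' \<tau> = id" by auto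
    then have "\<tau> = id" using permutes_inv_inv[OF \<tau>(2)] by (metis inv_id)
    then show "y \<in> sum_ext {id} 0" by (simp add: \<tau>(1) wr_in_sum_ext)
  qed
qed

lemma pseudocentre_subset_alt: "pseudocentre G \<subseteq> sum_ext (carrier (alt_group n)) 0"
proof -
  \<comment> \<open>The largest odd number up to \<open>n\<close>: the cycle (1 ... m) has odd
    length and misses at most one point.\<close>
  define m where "m = (if odd n then n else n - 1)"
  define cs where "cs = [1..<Suc m]"
  \<comment> \<open>An even \<open>n\<close> is thus at least 4, which gives
    \<open>3 \<le> m\<close> also in that case.\<close>
  have "even n \<Longrightarrow> n \<noteq> 3" by auto
  then have "odd m" "3 \<le> m" "m \<le> n" "n \<le> Suc m"
    using n_ge_3 by (cases "even n"; simp add: m_def)+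
  then have cs: "distinct cs" "odd (length cs)" "1 < length cs" "set cs \<subseteq> {1..n}"
    "card ({1..n} - set cs) \<le> 1"
    by (auto simp: cs_def card_Diff_subset simp del: upt_Suc)
  have per: "cycle_of_list cs permutes {1..n}"
    by (rule permutes_subset[OF cycle_permutes cs(4)])
  show ?thesis
  proof (rule pseudocentre_subset[OF wr_carrier[OF per] sum_ext_normal[OF alt_group_normal]])
    show "centralizer G (wr (cycle_of_list cs) (\<lambda>_. 0)) \<subseteq> sum_ext (carrier (alt_group n)) 0"
    proof
      fix y assume y: "y \<in> centralizer G (wr (cycle_of_list cs) (\<lambda>_. 0))"
      then obtain \<tau> w where \<tau>: "y = wr \<tau> w" "\<tau> permutes {1..n}"
        by (auto simp: centralizer_def carrier_G)
      have "\<tau> \<circ> cycle_of_list cs = cycle_of_list cs \<circ> \<tau>"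
        using y unfolding \<tau>(1) wr_in_centralizer[OF per \<tau>(2)] by blast
      from commutes_cycle_evenperm[OF cs finite_atLeastAtMost \<tau>(2) this]
      show "y \<in> sum_ext (carrier (alt_group n)) 0"
        using \<tau> by (simp add: wr_in_sum_ext alt_group_carrier)
    qed
  qed
qed

text \<open>A vector invariant under an n-cycle modulo \<open>p\<close> is constant, so its sum is a
  multiple of \<open>n\<close> and hence of \<open>p\<close>. Permutations are left unrestricted
  here; \<open>sum_ext_Int\<close> combines this bound with one on the permutations.\<close>

lemma pseudocentre_subset_sum_zero:
  assumes "p dvd n"
  shows "pseudocentre G \<subseteq> sum_ext (carrier (sym_group n)) 1"
proof -
  define cs where "cs = [1..<Suc n]"
  define \<sigma> where "\<sigma> = cycle_of_list cs"
  have cs: "distinct cs" "set cs = {1..n}" "length cs = n"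
    by (auto simp: cs_def simp del: upt_Suc)
  have \<sigma>: "\<sigma> permutes {1..n}"
    unfolding \<sigma>_def using cycle_permutes[of cs] cs(2) by simp
  have normal: "carrier (sym_group n) \<lhd> sym_group n"
    by (rule group.normal_self[OF sym_group_is_group])
  show ?thesis
  proof (rule pseudocentre_subset[OF wr_carrier[OF \<sigma>] sum_ext_normal[OF normal]])
    show "centralizer G (wr \<sigma> (\<lambda>_. 0)) \<subseteq> sum_ext (carrier (sym_group n)) 1"
    proof
      fix y assume y: "y \<in> centralizer G (wr \<sigma> (\<lambda>_. 0))"
      then obtain \<tau> w where \<tau>: "y = wr \<tau> w" "\<tau> permutes {1..n}"
        by (auto simp: centralizer_def carrier_G)
      have const: "w (\<sigma> i) mod int p = w i mod int p" if "i \<in> {1..n}" for i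
      proof -
        have "\<forall>j\<in>{1..n}. (w j + 0) mod int p = (0 + w (inv' \<sigma> j)) mod int p"
          using y unfolding \<tau>(1) wr_in_centralizer[OF \<sigma> \<tau>(2)] by blast
        moreover have "\<sigma> i \<in> {1..n}" using permutes_in_image[OF \<sigma>] that by blast
        ultimately have "(w (\<sigma> i) + 0) mod int p = (0 + w (inv' \<sigma> (\<sigma> i))) mod int p" by blast
        then show ?thesis by (simp only: permutes_inverses[OF \<sigma>] add_0 add_0_right)
      qed
      have pow: "w ((\<sigma> ^^ k) 1) mod int p = w 1 mod int p" for k
      proof (induction k)
        case 0
        show "w ((\<sigma> ^^ 0) 1) mod int p = w 1 mod int p" by simp
      next
        case (Suc k)
        have "(\<sigma> ^^ k) 1 \<in> {1..n}"
          unfolding permutes_in_image[OF permutes_funpow[OF \<sigma>]] using n_ge_3 by simp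
        from const[OF this] Suc show "w ((\<sigma> ^^ Suc k) 1) mod int p = w 1 mod int p" by simp
      qed
      have "w i mod int p = w 1 mod int p" if "i \<in> {1..n}" for i
      proof -
        \<comment> \<open>Lists are indexed from 0 and coordinates from 1, so coordinate
          \<open>i\<close> is reached from 1 by \<open>i - 1\<close> applications of
          \<open>\<sigma>\<close>.\<close>
        have "cs \<noteq> []" "cs ! 0 = 1" "cs ! (i - 1) = i" "(i - 1) mod n = i - 1"
          using that n_ge_3 by (auto simp: cs_def simp del: upt_Suc)
        then have "(\<sigma> ^^ (i - 1)) 1 = i"
          using cycle_funpow_hd[OF cs(1), of "i - 1"] cs(3) by (simp add: \<sigma>_def)
        then show ?thesis using pow[of "i - 1"] by simp
      qed
      then have "int p dvd (\<Sum>i\<in>{1..n}. w i - w 1)"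
        by (intro dvd_sum) (simp add: mod_eq_dvd_iff)
      then have "int p dvd (\<Sum>i\<in>{1..n}. w i) - int n * w 1"
        by (simp add: sum_subtractf)
      moreover have "int p dvd int n * w 1" using assms by simp
      ultimately have "int p dvd (\<Sum>i\<in>{1..n}. w i)"
        using dvd_add[of "int p" "(\<Sum>i\<in>{1..n}. w i) - int n * w 1" "int n * w 1"] by simp
      then show "y \<in> sum_ext (carrier (sym_group n)) 1"
        using \<tau> by (simp add: wr_in_sum_ext sym_group_carrier)
    qed
  qed
qed

section \<open>Combining the bounds\<close>

lemma sum_ext_Int:
  "sum_ext A 0 \<inter> sum_ext (carrier (sym_group n)) 1 \<subseteq> sum_ext A 1"
  by (auto simp: sum_ext_def[of A 0] wr_in_sum_ext)

lemma pseudocentre_eq: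
  shows "p < n \<Longrightarrow> \<not> p dvd n \<Longrightarrow> pseudocentre G = sum_ext (carrier (alt_group n)) 0"
    and "p < n \<Longrightarrow> p dvd n \<Longrightarrow> pseudocentre G = sum_ext (carrier (alt_group n)) 1"
    and "p = n \<Longrightarrow> pseudocentre G = sum_ext {id} 1"
    and "p > n \<Longrightarrow> pseudocentre G = sum_ext {id} 0"
proof -
  assume *: "p < n" "\<not> p dvd n"
  have "sum_ext (carrier (alt_group n)) 0 \<subseteq> pseudocentre G"
    by (intro subset_pseudocentre alt_sum_ext_in_N base_in_N *)
  then show "pseudocentre G = sum_ext (carrier (alt_group n)) 0"
    using pseudocentre_subset_alt by blast
next
  assume *: "p < n" "p dvd n"
  have "sum_ext (carrier (alt_group n)) 1 \<subseteq> pseudocentre G"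
    by (intro subset_pseudocentre alt_sum_ext_in_N sum_zero_in_N *)
  then show "pseudocentre G = sum_ext (carrier (alt_group n)) 1"
    using pseudocentre_subset_alt pseudocentre_subset_sum_zero[OF *(2)] sum_ext_Int by blast
next
  assume *: "p = n"
  have "sum_ext {id} 1 \<subseteq> pseudocentre G"
    by (intro subset_pseudocentre sum_zero_in_N)
  moreover have "n \<le> p" "p dvd n" using * by simp_all
  ultimately show "pseudocentre G = sum_ext {id} 1"
    using pseudocentre_subset_base pseudocentre_subset_sum_zero sum_ext_Int by blast
next
  assume *: "p > n"
  then have "\<not> p dvd n" using n_ge_3 by (auto dest: dvd_imp_le)
  then have "sum_ext {id} 0 \<subseteq> pseudocentre G"
    by (intro subset_pseudocentre base_in_N)
  then show "pseudocentre G = sum_ext {id} 0"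
    using pseudocentre_subset_base * by fastforce
qed

end

theorem theorem5p22:
  fixes n p :: nat
  defines "G \<equiv> wreath_Sym (integer_mod_group p) n"
    and "B \<equiv> base_group (integer_mod_group p) n"
    and "Alt \<equiv> Alt_in_wreath (integer_mod_group p) n"
  assumes "n \<ge> 3" and "Factorial_Ring.prime p"
  shows "(p < n \<and> \<not> p dvd n \<longrightarrow> is_internal_semidirect_product G (pseudocentre G) Alt B) \<and>
    (p < n \<and> p dvd n \<longrightarrow>
      is_internal_semidirect_product G (pseudocentre G) Alt (commutator_subgroup G Alt B)) \<and>
    (p = n \<longrightarrow> pseudocentre G = commutator_subgroup G Alt B) \<and>
    (p > n \<longrightarrow> pseudocentre G = B)"
proof -
  interpret W: prime_wreath n p
    using assms(4,5) by unfold_locales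
  note comm = W.commutator_subgroup_eq[OF assms(4)]
  show ?thesis
    \<comment> \<open>\<open>comm\<close> is unfolded first, since its left-hand side mentions the
      base group that \<open>W.base_group_eq\<close> rewrites.\<close>
    unfolding G_def B_def Alt_def comm unfolding W.base_group_eq
    using W.Alt_semidirect[of 0] W.Alt_semidirect[of 1] W.pseudocentre_eq by simp
qed

end
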